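(* Let $\mathfrak{g}_3$ be the real 3-dimensional Heisenberg Lie algebra with basis $e_1,e_2,e_3$ and brackets $[e_1,e_3]=0$, $[e_2,e_3]=0$, $[e_1,e_2]=e_3$. Each integrable complex structure $\mathcal{J}$ on $\mathfrak{g}_3\times\mathfrak{g}_3$ is, in some standard basis $(e_1,e_2,e_3,e_1^*,e_2^*,e_3^* )$ of $\mathfrak{g}_3\times\mathfrak{g}_3$, given by a matrix of one of the following two forms. Either it is $$ \left[ \begin{array}{cccccc} X & \frac{-1-X^2}{Y} & 0 & 0 & 0 & 0\\ Y & -X & 0 & 0 & 0 & 0\\ 0 & 0 & \lambda & 0 & 0 & -1-\lambda^2\\ 0 & 0 & 0 & X^* & \frac{-1-(X^* )^2}{Y^*} & 0\\ 0 & 0 & 0 & Y^* & -X^* & 0\\ 0 & 0 & 1 & 0 & 0 & -\lambda \end{array} \right] $$ for some real numbers $\lambda, X, X^*, Y, Y^*$ with $Y\neq 0$ and $Y^*\neq 0$, or it is $$ \left[ \begin{array}{cccccc} X & A & 0 & -1-X^2-AY & -A & 0\\ Y & B & 0 & - Y(X+B) & \frac{-1-B^2-AY}{X+B} & 0\\ Z & C & \lambda & -XZ-CY-Z\lambda & \frac{-AZ-BC-C\lambda}{X+B} & -1-\lambda^2\\ 1 & 0 & 0 & -X & \frac{-A}{X+B} & 0\\ 0 & X+B & 0 & -Y(X+B) & -B & 0\\ 0 & 0 & 1 & -Z & \frac{-C}{X+B} & -\lambda \end{array} \right] $$ for some real numbers $X,Y,Z,A,B,C$ with $X+B\neq 0$,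 and with $\lambda=\frac{-1+XB-AY}{X+B}$. Conversely, any such choice of numbers (in either form) provides an integrable complex structure on $\mathfrak{g}_3\times\mathfrak{g}_3$.
   Context: For a real Lie algebra $\mathfrak{g}$, the product $\mathfrak{g}\times\mathfrak{g}$ carries the componentwise bracket. Write $\mathfrak{g}=\mathfrak{g}\times 0$ and $\mathfrak{g}^*=0\times\mathfrak{g}$ (the asterisk only marks the second copy; it is not a dual space), and mark vectors of the second factor with an asterisk, so $[u+u^*,v+v^*]=[u,v]+[u^*,v^*]$. An integrable complex structure on $\mathfrak{g}\times\mathfrak{g}$ is a real-linear map $\mathcal{J}:\mathfrak{g}\times\mathfrak{g}\to\mathfrak{g}\times\mathfrak{g}$ with $\mathcal{J}^2=-\mathrm{id}$ and $[v,w]+\mathcal{J}[\mathcal{J}v,w]+\mathcal{J}[v,\mathcal{J}w]-[\mathcal{J}v,\mathcal{J}w]=0$ for all $v,w\in\mathfrak{g}\times\mathfrak{g}$. A standard basis of $\mathfrak{g}_3\times\mathfrak{g}_3$ is an ordered basis $(e_1,e_2,e_3,e_1^*,e_2^*,e_3^* )$ such that $e_1,e_2,e_3$ is a basis of the first factor satisfying $[e_1,e_3]=0$, $[e_2,e_3]=0$, $[e_1,e_2]=e_3$, and $e_1^*,e_2^*,e_3^*$ is a basis of the second factor satisfying $[e_1^*,e_3^*]=0$, $[e_2^*,e_3^*]=0$, $[e_1^*,e_2^*]=e_3^*$. Matrices act on column vectors: the $j$-th column contains the coordinates of the image under $\mathcal{J}$ of the $j$-th basis vector. The symbols $X^*,Y^*$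 denote real numbers independent of $X,Y$. *)

theory Defs
  imports "HOL-Analysis.Analysis"
begin

definition lie_bracket :: "('a::real_vector \<Rightarrow> 'a \<Rightarrow> 'a) \<Rightarrow> bool" where
  "lie_bracket br \<longleftrightarrow> bilinear br \<and> (\<forall>x. br x x = 0) \<and>
     (\<forall>x y z. br x (br y z) + br y (br z x) + br z (br x y) = 0)"

definition prod_bracket ::
    "('a::real_vector \<Rightarrow> 'a \<Rightarrow> 'a) \<Rightarrow> 'a \<times> 'a \<Rightarrow> 'a \<times> 'a \<Rightarrow> 'a \<times> 'a" where
  "prod_bracket br v w = (br (fst v) (fst w), br (snd v) (snd w))"

definition integrable_complex_structure ::
    "('a::real_vector \<Rightarrow> 'a \<Rightarrow> 'a) \<Rightarrow> ('a \<times> 'a \<Rightarrow> 'a \<times> 'a) \<Rightarrow> bool" where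
  "integrable_complex_structure br J \<longleftrightarrow>
     linear J \<and> (\<forall>v. J (J v) = - v) \<and>
     (\<forall>v w. prod_bracket br v w + J (prod_bracket br (J v) w)
            + J (prod_bracket br v (J w)) - prod_bracket br (J v) (J w) = 0)"

definition heis :: "real^3 \<Rightarrow> real^3 \<Rightarrow> real^3" where
  "heis x y = vector [0, 0, x$1 * y$2 - x$2 * y$1]"

definition ordered_basis_of :: "'a::real_vector list \<Rightarrow> 'a set \<Rightarrow> bool" where
  "ordered_basis_of bs V \<longleftrightarrow> distinct bs \<and> independent (set bs) \<and> span (set bs) = V"

text \<open>The entries of \<open>b\<close> with indices 1, ..., 6 are
  $e_1, e_2, e_3, e_1^*, e_2^*, e_3^*$. In the numeral type 6 the numeral 6 equals 0;
  nothing below depends on an order of the index type.\<close>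

definition standard_basis :: "((real^3) \<times> (real^3))^6 \<Rightarrow> bool" where
  "standard_basis b \<longleftrightarrow>
     ordered_basis_of [b$1, b$2, b$3] (UNIV \<times> {0}) \<and>
     prod_bracket heis (b$1) (b$3) = 0 \<and>
     prod_bracket heis (b$2) (b$3) = 0 \<and>
     prod_bracket heis (b$1) (b$2) = b$3 \<and>
     ordered_basis_of [b$4, b$5, b$6] ({0} \<times> UNIV) \<and>
     prod_bracket heis (b$4) (b$6) = 0 \<and>
     prod_bracket heis (b$5) (b$6) = 0 \<and>
     prod_bracket heis (b$4) (b$5) = b$6"

definition has_matrix ::
    "('a::real_vector \<Rightarrow> 'a) \<Rightarrow> 'a^'n \<Rightarrow> real^'n^'n \<Rightarrow> bool" where
  "has_matrix f b M \<longleftrightarrow> (\<forall>j. f (b$j) = (\<Sum>i\<in>UNIV. M$i$j *\<^sub>R b$i))"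

text \<open>Xs and Ys stand for $X^*$ and $Y^*$; the inner lists are the rows.\<close>

definition matrix_I :: "real \<Rightarrow> real \<Rightarrow> real \<Rightarrow> real \<Rightarrow> real \<Rightarrow> real^6^6" where
  "matrix_I l X Xs Y Ys = vector
    [vector [X, (-1 - X\<^sup>2) / Y, 0, 0, 0, 0],
     vector [Y, -X, 0, 0, 0, 0],
     vector [0, 0, l, 0, 0, -1 - l\<^sup>2],
     vector [0, 0, 0, Xs, (-1 - Xs\<^sup>2) / Ys, 0],
     vector [0, 0, 0, Ys, -Xs, 0],
     vector [0, 0, 1, 0, 0, -l]]"

definition matrix_II ::
    "real \<Rightarrow> real \<Rightarrow> real \<Rightarrow> real \<Rightarrow> real \<Rightarrow> real \<Rightarrow> real^6^6" where
  "matrix_II X Y Z A B C = (let l = (-1 + X*B - A*Y) / (X + B) in vector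
    [vector [X, A, 0, -1 - X\<^sup>2 - A*Y, -A, 0],
     vector [Y, B, 0, -Y*(X + B), (-1 - B\<^sup>2 - A*Y) / (X + B), 0],
     vector [Z, C, l, -X*Z - C*Y - Z*l, (-A*Z - B*C - C*l) / (X + B), -1 - l\<^sup>2],
     vector [1, 0, 0, -X, -A / (X + B), 0],
     vector [0, X + B, 0, -Y*(X + B), -B, 0],
     vector [0, 0, 1, -Z, -C / (X + B), -l]])"

text \<open>Checks: the brackets are Lie brackets, the unit vectors of \<open>real^3\<close> satisfy the
  Heisenberg relations, and \<open>vector\<close> places the entries of a six-element list as intended.\<close>

lemma lie_bracket_heis: "lie_bracket heis"
  unfolding lie_bracket_def bilinear_def
  by (auto intro!: linearI simp: heis_def vec_eq_iff forall_3 vector_3 algebra_simps)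

lemma lie_bracket_prod:
  assumes "lie_bracket br"
  shows "lie_bracket (prod_bracket br)"
  using assms unfolding lie_bracket_def bilinear_def linear_iff
  by (simp add: prod_bracket_def zero_prod_def scaleR_prod_def)

lemma heis_axis:
  "heis (axis 1 1) (axis 3 1) = 0"
  "heis (axis 2 1) (axis 3 1) = 0"
  "heis (axis 1 1) (axis 2 1) = axis 3 1"
  by (simp_all add: heis_def vec_eq_iff forall_3 vector_3 axis_def)

lemma vector_6:
  "(vector [u,v,w,x,y,z] :: ('a::zero)^6) $ 1 = u"
  "(vector [u,v,w,x,y,z] :: ('a::zero)^6) $ 2 = v"
  "(vector [u,v,w,x,y,z] :: ('a::zero)^6) $ 3 = w"
  "(vector [u,v,w,x,y,z] :: ('a::zero)^6) $ 4 = x"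
  "(vector [u,v,w,x,y,z] :: ('a::zero)^6) $ 5 = y"
  "(vector [u,v,w,x,y,z] :: ('a::zero)^6) $ 6 = z"
  unfolding vector_def by simp_all

end

theory Submission
  imports Defs
begin

text \<open>
  For a central vector \<open>v\<close> the Nijenhuis condition says that \<open>ad (J v)\<close> commutes with \<open>J\<close>; as the image of
  \<open>ad (J v)\<close> lies in the 2-dimensional centre, this forces the centre to be \<open>J\<close>-invariant.
  Write \<open>J e\<^sub>3 = \<lambda> e\<^sub>3 + c e\<^sub>3\<^sup>*\<close> and \<open>J e\<^sub>i = P e\<^sub>i + R e\<^sub>i\<close> along the two factors. The Nijenhuis
  condition for \<open>e\<^sub>1, e\<^sub>2\<close> then reads \<open>1 + \<lambda> tr P = det P\<close> and
  \<open>[R e\<^sub>1, R e\<^sub>2] = c tr P e\<^sub>3\<^sup>*\<close>, with trace and determinant taken modulo the centre.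
  If \<open>tr P \<noteq> 0\<close>, then \<open>R e\<^sub>1\<close>, \<open>R e\<^sub>2 / tr P\<close> and \<open>c e\<^sub>3\<^sup>*\<close> complete
  \<open>e\<^sub>1, e\<^sub>2, e\<^sub>3\<close> to a standard basis and \<open>J\<close> has the second form, whose last columns are forced
  by \<open>J\<^sup>2 = -1\<close>. If \<open>tr P = 0\<close>, then \<open>det P = 1\<close>, so \<open>P\<close> has no real eigenvector modulo
  the centre, while \<open>R\<close> is singular with \<open>P\<close>-invariant kernel; hence \<open>R\<close> vanishes modulo the centre
  and central shifts of the basis vectors give the first form.
\<close>

subsection \<open>Matrices over a six-element basis\<close>

lemma exhaust_6: "x = 1 \<or> x = 2 \<or> x = 3 \<or> x = 4 \<or> x = 5 \<or> x = 6" for x :: 6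
proof (induct x)
  case (of_int z)
  then have "0 \<le> z" "z < 6" by simp_all
  \<comment> \<open>The residue 0 supplies the last case, being the numeral 6 of this type.\<close>
  then have "z = 0 \<or> z = 1 \<or> z = 2 \<or> z = 3 \<or> z = 4 \<or> z = 5" by arith
  then show ?case by auto
qed

lemma forall_6: "(\<forall>i::6. P i) \<longleftrightarrow> P 1 \<and> P 2 \<and> P 3 \<and> P 4 \<and> P 5 \<and> P 6"
  by (metis exhaust_6)

lemma UNIV_6: "UNIV = {1, 2, 3, 4, 5, 6::6}"
  using exhaust_6 by auto

lemma sum_6: "sum f (UNIV::6 set) = f 1 + f 2 + f 3 + f 4 + f 5 + f 6"
  unfolding UNIV_6 by (simp add: ac_simps)

lemma has_matrix_6:
  fixes b :: "'a::real_vector^6"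
  shows "has_matrix f b M \<longleftrightarrow> (\<forall>j. f (b $ j) = M$1$j *\<^sub>R b$1 + M$2$j *\<^sub>R b$2 + M$3$j *\<^sub>R b$3
     + M$4$j *\<^sub>R b$4 + M$5$j *\<^sub>R b$5 + M$6$j *\<^sub>R b$6)"
  by (simp add: has_matrix_def sum_6)

lemma has_matrix_compose:
  assumes "linear f" "has_matrix f b M" "has_matrix g b N"
  shows "has_matrix (f \<circ> g) b (M ** N)"
proof -
  have "f (g (b $ j)) = (\<Sum>i\<in>UNIV. (M ** N) $ i $ j *\<^sub>R b $ i)" for j
  proof -
    have "f (g (b $ j)) = (\<Sum>k\<in>UNIV. N $ k $ j *\<^sub>R f (b $ k))"
      using assms by (simp add: has_matrix_def linear_sum linear_cmul)
    also have "\<dots> = (\<Sum>k\<in>UNIV. \<Sum>i\<in>UNIV. (M $ i $ k * N $ k $ j) *\<^sub>R b $ i)"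
      using assms(2) by (simp add: has_matrix_def scaleR_sum_right mult.commute)
    also have "\<dots> = (\<Sum>i\<in>UNIV. (M ** N) $ i $ j *\<^sub>R b $ i)"
      by (subst sum.swap) (simp add: matrix_matrix_mult_def scaleR_sum_left)
    finally show ?thesis .
  qed
  then show ?thesis by (simp add: has_matrix_def)
qed

lemma matrix_I_square:
  assumes "Y \<noteq> 0" "Ys \<noteq> 0"
  shows "matrix_I l X Xs Y Ys ** matrix_I l X Xs Y Ys = - mat 1"
  using assms
  by (simp add: vec_eq_iff forall_6 matrix_matrix_mult_def sum_6 matrix_I_def vector_6 mat_def
      power2_eq_square)

lemma matrix_II_square:
  assumes "X + B \<noteq> 0"
  shows "matrix_II X Y Z A B C ** matrix_II X Y Z A B C = - mat 1"
proof -
  define s where "s = X + B"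
  define l where "l = (-1 + X*B - A*Y) / s"
  have [simp]: "s \<noteq> 0" using assms by (simp add: s_def)
  \<comment> \<open>The denominator is kept as the atom \<open>s\<close> so that divisions can be
    cleared; eliminating \<open>B\<close> afterwards leaves polynomial identities.\<close>
  have B: "B = s - X" by (simp add: s_def)
  show ?thesis
    apply (simp add: vec_eq_iff forall_6 matrix_matrix_mult_def sum_6 matrix_II_def vector_6 mat_def
        Let_def flip: s_def l_def)
    apply (simp add: field_simps power2_eq_square)
    apply (simp add: B algebra_simps)
    done
qed

section \<open>Linear maps determined by a matrix\<close>

lemma has_matrix_unique:
  assumes "span (range (($) b)) = UNIV" "linear f" "linear g" "has_matrix f b M" "has_matrix g b M"
  shows "f = g"
proof
  have "f x = g x" if "x \<in> range (($) b)" for x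
    using that assms(4,5) by (auto simp: has_matrix_def)
  then show "f x = g x" for x
    using linear_eq_on_span[OF assms(2,3), of "range (($) b)" x] assms(1) by auto
qed

text \<open>A spanning family with as many members as the dimension has no room for a repetition or
  a dependence.\<close>

lemma span_range_imp_basis:
  fixes b :: "'a::euclidean_space^'n"
  assumes "span (range (($) b)) = UNIV" "CARD('n) = DIM('a)"
  shows "inj (($) b)" "independent (range (($) b))"
proof -
  have "DIM('a) \<le> card (range (($) b))"
    using assms(1) by (metis dim_UNIV dim_le_card finite finite_imageI order_refl)
  then have c: "card (range (($) b)) = CARD('n)"
    using assms(2) card_image_le[OF finite, of "($) b" UNIV] by simp
  then show "inj (($) b)" by (simp add: eq_card_imp_inj_on)
  show "independent (range (($) b))"
    by (rule card_le_dim_spanning[of _ UNIV]) (use assms c in auto)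
qed

lemma ex1_linear_has_matrix:
  fixes b :: "'a::euclidean_space^'n"
  assumes "span (range (($) b)) = UNIV" "CARD('n) = DIM('a)"
  shows "\<exists>!J. linear J \<and> has_matrix J b M"
proof -
  note basis = span_range_imp_basis[OF assms]
  \<comment> \<open>Injectivity lets \<open>inv\<close> recover the column index from a basis
    vector.\<close>
  define f where "f x = (\<Sum>i\<in>UNIV. M $ i $ inv (($) b) x *\<^sub>R b $ i)" for x
  obtain g where "linear g" "\<forall>x\<in>range (($) b). g x = f x"
    using linear_independent_extend[OF basis(2)] by blast
  then have "linear g \<and> has_matrix g b M"
    by (simp add: has_matrix_def f_def inv_f_f[OF basis(1)])
  moreover have "J = g" if "linear J \<and> has_matrix J b M" "linear g \<and> has_matrix g b M" for J g
    using that assms(1) by (blast intro: has_matrix_unique)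
  ultimately show ?thesis by blast
qed

lemma has_matrix_minus_id: "has_matrix uminus b (- mat 1)"
  by (simp add: has_matrix_def mat_def if_distrib if_distribR sum_negf cong: if_cong)

lemma square_eq_minus_id:
  assumes "span (range (($) b)) = UNIV" "linear J" "has_matrix J b M" "M ** M = - mat 1"
  shows "J (J v) = - v"
proof -
  have "J \<circ> J = uminus"
  proof (rule has_matrix_unique[OF assms(1)])
    show "linear (J \<circ> J)" using assms(2) by (simp add: linear_compose)
    show "linear (uminus :: 'a \<Rightarrow> 'a)" by (intro linearI) auto
    show "has_matrix (J \<circ> J) b (- mat 1)"
      using has_matrix_compose[OF assms(2,3,3)] assms(4) by simp
  qed (rule has_matrix_minus_id)
  then show ?thesis by (simp add: fun_eq_iff)
qed

lemma range_nth_6: "range (($) b) = {b $ 1, b $ 2, b $ 3, b $ 4, b $ 5, b $ (6::6)}"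
  by (simp add: UNIV_6)

lemma standard_basis_span:
  assumes "standard_basis b"
  shows "span (range (($) b)) = UNIV"
proof -
  have "span {b$1, b$2, b$3} = UNIV \<times> {0}" "span {b$4, b$5, b$6} = {0} \<times> UNIV"
    using assms by (auto simp: standard_basis_def ordered_basis_of_def)
  moreover have "range (($) b) = {b$1, b$2, b$3} \<union> {b$4, b$5, b$6}"
    by (auto simp: range_nth_6)
  ultimately have "span (range (($) b)) = {x + y |x y. x \<in> UNIV \<times> {0} \<and> y \<in> {0} \<times> UNIV}"
    by (simp only: span_Un)
  also have "\<dots> = UNIV"
  proof safe
    fix x y :: "real^3"
    have "(x, y) = (x, 0) + (0, y)" by simp
    then show "\<exists>u v. (x, y) = u + v \<and> u \<in> UNIV \<times> {0} \<and> v \<in> {0} \<times> UNIV" by blast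
  qed simp
  finally show ?thesis .
qed

subsection \<open>The Nijenhuis tensor\<close>

definition nijenhuis ::
    "('a::real_vector \<Rightarrow> 'a \<Rightarrow> 'a) \<Rightarrow> ('a \<Rightarrow> 'a) \<Rightarrow> 'a \<Rightarrow> 'a \<Rightarrow> 'a" where
  "nijenhuis br J v w = br v w + J (br (J v) w) + J (br v (J w)) - br (J v) (J w)"

lemma integrable_iff_nijenhuis:
  "integrable_complex_structure br J \<longleftrightarrow>
     linear J \<and> (\<forall>v. J (J v) = - v) \<and> (\<forall>v w. nijenhuis (prod_bracket br) J v w = 0)"
  by (simp add: integrable_complex_structure_def nijenhuis_def)

lemma bilinear_nijenhuis:
  assumes "bilinear br" "linear J"
  shows "bilinear (nijenhuis br J)"
  using assms unfolding bilinear_def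
  by (auto simp: linear_iff nijenhuis_def algebra_simps)

lemma nijenhuis_swap:
  assumes "lie_bracket br" "linear J"
  shows "nijenhuis br J w v = - nijenhuis br J v w"
proof -
  have swap: "br y x = - br x y" for x y
  proof -
    have "bilinear br" "br (x + y) (x + y) = 0" "br x x = 0" "br y y = 0"
      using assms(1) by (auto simp: lie_bracket_def)
    then show ?thesis
      by (simp add: bilinear_ladd bilinear_radd eq_neg_iff_add_eq_0 add.commute)
  qed
  show ?thesis
    using swap[of v w] swap[of "J v" w] swap[of v "J w"] swap[of "J v" "J w"]
    by (simp add: nijenhuis_def linear_neg[OF assms(2)])
qed

lemma nijenhuis_J_left:
  assumes "bilinear br" "linear J" "\<And>v. J (J v) = - v"
  shows "nijenhuis br J (J v) w = - J (nijenhuis br J v w)"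
  by (simp add: nijenhuis_def assms(3) bilinear_lneg[OF assms(1)] linear_neg[OF assms(2)]
      linear_add[OF assms(2)] linear_diff[OF assms(2)])

text \<open>Since \<open>N (J v) w = - J (N v w)\<close>, the Nijenhuis tensor only has to be tested on
  vectors generating the space over the complex numbers.\<close>

lemma nijenhuis_eq_0:
  assumes br: "lie_bracket br" and J: "linear J" "\<And>v. J (J v) = - v"
    and gen: "\<And>T. subspace T \<Longrightarrow> J ` T \<subseteq> T \<Longrightarrow> {a, b, c} \<subseteq> T \<Longrightarrow> T = UNIV"
    and 0: "nijenhuis br J a b = 0" "nijenhuis br J a c = 0" "nijenhuis br J b c = 0"
  shows "nijenhuis br J v w = 0"
proof -
  let ?N = "nijenhuis br J"
  have bil: "bilinear br" using br by (simp add: lie_bracket_def)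
  note N = bilinear_nijenhuis[OF bil J(1)] and swap = nijenhuis_swap[OF br J(1)]
    and left = nijenhuis_J_left[OF bil J]
  have right: "?N x (J y) = - J (?N x y)" for x y
    using left[of y x] swap[of x y] swap[of x "J y"] by (simp add: linear_neg[OF J(1)])
  have self: "?N x x = 0" for x
    using swap[of x x] by (simp add: eq_neg_iff_add_eq_0 flip: scaleR_2)
  \<comment> \<open>\<open>gen\<close> is applied twice: first in the second argument with a
    generator fixed in the first, then in the first argument. Both zero sets are
    \<open>J\<close>-invariant by antilinearity.\<close>
  have "{w. ?N x w = 0} = UNIV" if "x \<in> {a, b, c}" for x
  proof (rule gen)
    show "subspace {w. ?N x w = 0}"
      by (simp add: subspace_def bilinear_rzero[OF N] bilinear_radd[OF N] bilinear_rmul[OF N])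
    show "J ` {w. ?N x w = 0} \<subseteq> {w. ?N x w = 0}" by (auto simp: right linear_0[OF J(1)])
    show "{a, b, c} \<subseteq> {w. ?N x w = 0}"
      using that 0 self swap[of a b] swap[of a c] swap[of b c] by auto
  qed
  then have abc: "?N x w = 0" if "x \<in> {a, b, c}" for x w using that by blast
  have "{v. \<forall>w. ?N v w = 0} = UNIV"
  proof (rule gen)
    show "subspace {v. \<forall>w. ?N v w = 0}"
      by (simp add: subspace_def bilinear_lzero[OF N] bilinear_ladd[OF N] bilinear_lmul[OF N])
    show "J ` {v. \<forall>w. ?N v w = 0} \<subseteq> {v. \<forall>w. ?N v w = 0}"
      by (auto simp: left linear_0[OF J(1)])
    show "{a, b, c} \<subseteq> {v. \<forall>w. ?N v w = 0}" using abc by blast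
  qed
  then show ?thesis by blast
qed

subsection \<open>The product of two Heisenberg algebras\<close>

text \<open>The determinant form on the quotient by the centre, which is all of its arguments that
  the bracket sees.\<close>

definition area :: "real^3 \<Rightarrow> real^3 \<Rightarrow> real" where
  "area x y = x$1 * y$2 - x$2 * y$1"

definition cen :: "real \<Rightarrow> real^3" where
  "cen a = vector [0, 0, a]"

lemma cen_nth [simp]: "cen a $ 1 = 0" "cen a $ 2 = 0" "cen a $ 3 = a"
  by (simp_all add: cen_def)

lemma axis_nth_3 [simp]:
  "axis 1 a $ (2::3) = 0" "axis 1 a $ (3::3) = 0" "axis 2 a $ (1::3) = 0"
  "axis 2 a $ (3::3) = 0" "axis i a $ (i::3) = a"
  by (simp_all add: axis_def)

lemma heis_eq_cen_area: "heis x y = cen (area x y)"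
  by (simp add: heis_def cen_def area_def)

lemma vec3_eq_iff: "x = y \<longleftrightarrow> x$1 = y$1 \<and> x$2 = y$2 \<and> x$3 = (y$3 :: real)" for x y :: "real^3"
  by (simp add: vec_eq_iff forall_3)

lemma prod_bracket_heis: "prod_bracket heis v w = (cen (area (fst v) (fst w)), cen (area (snd v) (snd w)))"
  by (simp add: prod_bracket_def heis_eq_cen_area)

lemma cen_0 [simp]: "cen 0 = 0" by (simp add: vec3_eq_iff)

text \<open>Two-step nilpotency. It makes the third and sixth vectors of a standard basis central,
  since they are brackets.\<close>

lemma prod_bracket_heis_nested [simp]:
  "prod_bracket heis x (prod_bracket heis y z) = 0"
  "prod_bracket heis (prod_bracket heis y z) x = 0"
  by (simp_all add: prod_bracket_heis area_def zero_prod_def)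

section \<open>Both matrix forms give integrable structures\<close>

lemma has_matrix_integrable:
  assumes b: "standard_basis b" and J: "linear J" "has_matrix J b M" "M ** M = - mat 1"
    and gen: "\<And>T. subspace T \<Longrightarrow> J ` T \<subseteq> T \<Longrightarrow> {b $ i, b $ j, b $ k} \<subseteq> T \<Longrightarrow> range (($) b) \<subseteq> T"
    and 0: "nijenhuis (prod_bracket heis) J (b $ i) (b $ j) = 0"
      "nijenhuis (prod_bracket heis) J (b $ i) (b $ k) = 0"
      "nijenhuis (prod_bracket heis) J (b $ j) (b $ k) = 0"
  shows "integrable_complex_structure heis J"
proof -
  note sq = square_eq_minus_id[OF standard_basis_span[OF b] J]
  have "T = UNIV" if "subspace T" "J ` T \<subseteq> T" "{b $ i, b $ j, b $ k} \<subseteq> T" for T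
    using span_minimal[OF gen[OF that] that(1)] standard_basis_span[OF b] by auto
  from nijenhuis_eq_0[OF lie_bracket_prod[OF lie_bracket_heis] J(1) sq this 0] sq J(1)
  show ?thesis by (simp add: integrable_iff_nijenhuis)
qed

lemma standard_basis_brackets:
  assumes "standard_basis b"
  shows "i \<in> {1, 2, 3} \<Longrightarrow> j \<in> {4, 5, 6} \<Longrightarrow> prod_bracket heis (b $ i) (b $ j) = 0"
    and "prod_bracket heis (b $ 1) (b $ 2) = b $ 3"
    and "prod_bracket heis (b $ 4) (b $ 5) = b $ 6"
    and "prod_bracket heis x (b $ 3) = 0" "prod_bracket heis (b $ 3) x = 0"
    and "prod_bracket heis x (b $ 6) = 0" "prod_bracket heis (b $ 6) x = 0"
proof -
  show 36: "prod_bracket heis (b $ 1) (b $ 2) = b $ 3" "prod_bracket heis (b $ 4) (b $ 5) = b $ 6"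
    using assms by (auto simp: standard_basis_def)
  show "prod_bracket heis x (b $ 3) = 0" "prod_bracket heis (b $ 3) x = 0"
    "prod_bracket heis x (b $ 6) = 0" "prod_bracket heis (b $ 6) x = 0"
    by (simp_all flip: 36)
  assume "i \<in> {1, 2, 3}" "j \<in> {4, 5, 6}"
  have "span {b$1, b$2, b$3} = UNIV \<times> {0}" "span {b$4, b$5, b$6} = {0} \<times> UNIV"
    using assms by (auto simp: standard_basis_def ordered_basis_of_def)
  with span_superset[of "{b$1, b$2, b$3}"] span_superset[of "{b$4, b$5, b$6}"]
  have "{b$1, b$2, b$3} \<subseteq> UNIV \<times> {0}" "{b$4, b$5, b$6} \<subseteq> {0} \<times> UNIV" by metis+
  with \<open>i \<in> _\<close> \<open>j \<in> _\<close> have "snd (b $ i) = 0" "fst (b $ j) = 0" by auto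
  then show "prod_bracket heis (b $ i) (b $ j) = 0"
    by (simp add: prod_bracket_heis area_def zero_prod_def)
qed

lemma bilinear_prod_bracket_heis: "bilinear (prod_bracket heis)"
  using lie_bracket_prod[OF lie_bracket_heis] by (simp add: lie_bracket_def)

lemmas prod_bracket_heis_bilinear =
  bilinear_ladd[OF bilinear_prod_bracket_heis] bilinear_radd[OF bilinear_prod_bracket_heis]
  bilinear_lmul[OF bilinear_prod_bracket_heis] bilinear_rmul[OF bilinear_prod_bracket_heis]

lemma prod_bracket_heis_self: "prod_bracket heis x x = 0"
  by (simp add: prod_bracket_heis area_def zero_prod_def)

lemma prod_bracket_heis_swap: "prod_bracket heis y x = - prod_bracket heis x y"
  by (simp add: prod_bracket_heis area_def vec3_eq_iff)

text \<open>Over the complex numbers e1, e1* and e3 generate the space, as Y and Y* are non-zero.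
  Their Nijenhuis values vanish because the two factors commute and J e3 is central.\<close>

lemma matrix_I_integrable:
  assumes b: "standard_basis b" and Y: "Y \<noteq> 0" "Ys \<noteq> 0"
    and J: "linear J" "has_matrix J b (matrix_I l X Xs Y Ys)"
  shows "integrable_complex_structure heis J"
proof (rule has_matrix_integrable[OF b J matrix_I_square[OF Y], of 1 4 3])
  have J1: "J (b$1) = X *\<^sub>R b$1 + Y *\<^sub>R b$2" and J3: "J (b$3) = l *\<^sub>R b$3 + b$6"
    and J4: "J (b$4) = Xs *\<^sub>R b$4 + Ys *\<^sub>R b$5"
    using J(2) by (simp_all add: has_matrix_6 matrix_I_def vector_6)
  note br = standard_basis_brackets[OF b]
  note simps = nijenhuis_def J1 J3 J4 br prod_bracket_heis_bilinear linear_0[OF J(1)]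
  show "nijenhuis (prod_bracket heis) J (b $ 1) (b $ 4) = 0"
    "nijenhuis (prod_bracket heis) J (b $ 1) (b $ 3) = 0"
    "nijenhuis (prod_bracket heis) J (b $ 4) (b $ 3) = 0"
    by (simp_all add: simps)
  fix T assume T: "subspace T" "J ` T \<subseteq> T" "{b $ 1, b $ 4, b $ 3} \<subseteq> T"
  have "b$2 = (1/Y) *\<^sub>R (J (b$1) - X *\<^sub>R b$1)" "b$5 = (1/Ys) *\<^sub>R (J (b$4) - Xs *\<^sub>R b$4)"
    "b$6 = J (b$3) - l *\<^sub>R b$3"
    using Y by (simp_all add: J1 J3 J4)
  moreover have "J (b$1) \<in> T" "J (b$3) \<in> T" "J (b$4) \<in> T" using T by auto
  ultimately have "b$2 \<in> T" "b$5 \<in> T" "b$6 \<in> T"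
    using T by (metis insert_subset subspace_scale subspace_diff)+
  with T show "range (($) b) \<subseteq> T" by (simp add: range_nth_6)
qed

lemma matrix_II_integrable:
  assumes b: "standard_basis b" and XB: "X + B \<noteq> 0"
    and J: "linear J" "has_matrix J b (matrix_II X Y Z A B C)"
  shows "integrable_complex_structure heis J"
proof (rule has_matrix_integrable[OF b J matrix_II_square[OF XB], of 1 2 3])
  define l where "l = (-1 + X*B - A*Y) / (X + B)"
  have l: "1 + (X + B) * l = X * B - A * Y" using XB by (simp add: l_def)
  have J1: "J (b$1) = X *\<^sub>R b$1 + Y *\<^sub>R b$2 + Z *\<^sub>R b$3 + b$4"
    and J2: "J (b$2) = A *\<^sub>R b$1 + B *\<^sub>R b$2 + C *\<^sub>R b$3 + (X + B) *\<^sub>R b$5"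
    and J3: "J (b$3) = l *\<^sub>R b$3 + b$6"
    using J(2) by (simp_all add: has_matrix_6 matrix_II_def vector_6 Let_def l_def)
  note br = standard_basis_brackets[OF b]
  have 21: "prod_bracket heis (b$2) (b$1) = - b$3"
    using prod_bracket_heis_swap[of "b$1" "b$2"] br(2) by simp
  have cross: "prod_bracket heis (b$4) (b$i) = 0" "prod_bracket heis (b$5) (b$i) = 0"
    if "i \<in> {1,2,3}" for i
    using prod_bracket_heis_swap[of "b$i" "b$4"] prod_bracket_heis_swap[of "b$i" "b$5"] br(1)[OF that]
    by simp_all
  note simps = nijenhuis_def J1 J2 J3 br 21 cross prod_bracket_heis_self prod_bracket_heis_bilinear
    linear_0[OF J(1)] linear_add[OF J(1)] linear_cmul[OF J(1)]
  \<comment> \<open>The e3* parts of (X + B) J e3 and of [J e1, J e2] cancel; the coefficient left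
    at e3 is the equation that defines \<lambda>.\<close>
  have "nijenhuis (prod_bracket heis) J (b $ 1) (b $ 2) = (1 + (X + B) * l - (X * B - A * Y)) *\<^sub>R b$3"
    by (simp add: simps algebra_simps)
  then show "nijenhuis (prod_bracket heis) J (b $ 1) (b $ 2) = 0"
    by (simp add: l)
  show "nijenhuis (prod_bracket heis) J (b $ 1) (b $ 3) = 0"
    "nijenhuis (prod_bracket heis) J (b $ 2) (b $ 3) = 0"
    by (simp_all add: simps)
  fix T assume T: "subspace T" "J ` T \<subseteq> T" "{b $ 1, b $ 2, b $ 3} \<subseteq> T"
  have "b$4 = J (b$1) - X *\<^sub>R b$1 - Y *\<^sub>R b$2 - Z *\<^sub>R b$3"
    "b$5 = (1/(X+B)) *\<^sub>R (J (b$2) - A *\<^sub>R b$1 - B *\<^sub>R b$2 - C *\<^sub>R b$3)"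
    "b$6 = J (b$3) - l *\<^sub>R b$3"
    using XB by (simp_all add: J1 J2 J3)
  moreover have "J (b$1) \<in> T" "J (b$2) \<in> T" "J (b$3) \<in> T" using T by auto
  ultimately have "b$4 \<in> T" "b$5 \<in> T" "b$6 \<in> T"
    using T by (metis insert_subset subspace_scale subspace_diff)+
  with T show "range (($) b) \<subseteq> T" by (simp add: range_nth_6)
qed


section \<open>Constructing standard bases\<close>

lemma ordered_basis_of_map:
  assumes "ordered_basis_of bs UNIV" "linear f" "inj f"
  shows "ordered_basis_of (map f bs) (range f)"
  using assms linear_independent_injective_image[OF assms(2), of "set bs"]
    linear_span_image[OF assms(2), of "set bs"] inj_on_subset[OF assms(3)]
  by (simp add: ordered_basis_of_def distinct_map)

lemma heis_ordered_basis:
  assumes "area x y = t" "t \<noteq> 0"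
  shows "ordered_basis_of [x, y, cen t] UNIV"
proof -
  have "v \<in> span {x, y, cen t}" for v
  proof -
    \<comment> \<open>Cramer's rule in the quotient by the centre; the third coordinate is then
      corrected by a multiple of \<open>cen t\<close>.\<close>
    define a b where "a = area v y / t" and "b = area x v / t"
    have "a * x$i + b * y$i = v$i" if "i \<in> {1, 2}" for i
    proof -
      have "area v y * x$i + area x v * y$i = t * v$i"
        using that unfolding assms(1)[symmetric] area_def by (auto simp: algebra_simps)
      then show ?thesis using assms(2) by (simp add: a_def b_def field_simps)
    qed
    then have "v = a *\<^sub>R x + b *\<^sub>R y + ((v$3 - a * x$3 - b * y$3) / t) *\<^sub>R cen t"
      using assms(2) by (simp add: vec3_eq_iff)
    then show ?thesis
      by (metis insertCI span_add span_base span_scale)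
  qed
  then have span: "span {x, y, cen t} = UNIV" by blast
  then have "3 \<le> card {x, y, cen t}"
    using dim_le_card[of UNIV "{x, y, cen t}"] by simp
  then have dist: "distinct [x, y, cen t]"
    by (auto simp: card_insert_if split: if_splits)
  then have "card {x, y, cen t} = 3" by simp
  then have "independent {x, y, cen t}"
    by (intro card_le_dim_spanning[of _ UNIV]) (auto simp: span)
  with span dist show ?thesis by (simp add: ordered_basis_of_def)
qed

lemma standard_basis_vector:
  assumes "area x y = t" "t \<noteq> 0" "area z w = s" "s \<noteq> 0"
  shows "standard_basis (vector [(x, 0), (y, 0), (cen t, 0), (0, z), (0, w), (0, cen s)])"
proof -
  have "linear (\<lambda>v :: real^3. (v, 0 :: real^3))" "linear (\<lambda>v :: real^3. (0 :: real^3, v))"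
    by (auto intro!: linearI)
  moreover have "inj (\<lambda>v :: real^3. (v, 0 :: real^3))" "inj (\<lambda>v :: real^3. (0 :: real^3, v))"
    by (auto intro!: injI)
  moreover have "range (\<lambda>v :: real^3. (v, 0 :: real^3)) = UNIV \<times> {0}"
    "range (\<lambda>v :: real^3. (0 :: real^3, v)) = {0} \<times> UNIV"
    by auto
  ultimately have "ordered_basis_of [(x, 0 :: real^3), (y, 0), (cen t, 0)] (UNIV \<times> {0})"
    "ordered_basis_of [(0 :: real^3, z), (0, w), (0, cen s)] ({0} \<times> UNIV)"
    using ordered_basis_of_map[OF heis_ordered_basis[OF assms(1,2)], of "\<lambda>v. (v, 0 :: real^3)"]
      ordered_basis_of_map[OF heis_ordered_basis[OF assms(3,4)], of "\<lambda>v. (0 :: real^3, v)"]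
    by simp_all
  then show ?thesis
    using assms(1,3)
    by (simp add: standard_basis_def vector_6 prod_bracket_heis zero_prod_def) (simp add: area_def)
qed

text \<open>A real eigenvalue \<open>k\<close> would satisfy k^2 = -1.\<close>

lemma no_real_eigenvector:
  assumes "linear J" "J (J v) = - v" "J v = k *\<^sub>R v"
  shows "v = (0 :: 'a::real_vector)"
proof -
  have "(k * k) *\<^sub>R v = - v"
    using assms(2) by (simp add: assms(3) linear_cmul[OF assms(1)])
  then have "(k * k + 1) *\<^sub>R v = 0" by (simp add: scaleR_left_distrib)
  moreover have "k * k + 1 > 0" by (simp add: add_nonneg_pos)
  ultimately show ?thesis by simp
qed

subsection \<open>Normal forms\<close>

locale heis_complex_structure =
  fixes J :: "(real^3) \<times> (real^3) \<Rightarrow> (real^3) \<times> (real^3)"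
  assumes integrable: "integrable_complex_structure heis J"
begin

lemma linear_J: "linear J" and J_J [simp]: "J (J v) = - v"
  and nijenhuis_0: "nijenhuis (prod_bracket heis) J v w = 0"
  using integrable unfolding integrable_iff_nijenhuis by blast+

lemmas J_simps = linear_add[OF linear_J] linear_cmul[OF linear_J] linear_diff[OF linear_J]
  linear_neg[OF linear_J] linear_0[OF linear_J]

text \<open>A single central vector with central image suffices for the centre to be invariant,
  because it spans the centre over the complex numbers.\<close>

lemma center_invariant_if:
  assumes t: "(cen t1, cen t2) \<noteq> 0" "J (cen t1, cen t2) = (cen s1, cen s2)"
  shows "\<exists>c d. J (cen a, cen b) = (cen c, cen d)"
proof (cases "t1 * s2 - t2 * s1 = 0")
  case True
  have nz: "t1 * t1 + t2 * t2 \<noteq> 0"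
    using t(1) by (auto simp: sum_squares_eq_zero_iff zero_prod_def)
  \<comment> \<open>The vectors are parallel, and \<open>k\<close> is the coefficient of the
    orthogonal projection. Its denominator is non-zero whichever of \<open>t1\<close>,
    \<open>t2\<close> is non-zero.\<close>
  define k where "k = (s1 * t1 + s2 * t2) / (t1 * t1 + t2 * t2)"
  have "s1 * (t1 * t1 + t2 * t2) = (s1 * t1 + s2 * t2) * t1"
    "s2 * (t1 * t1 + t2 * t2) = (s1 * t1 + s2 * t2) * t2"
    using True by algebra+
  then have "s1 = k * t1" "s2 = k * t2"
    using nz by (simp_all add: k_def field_simps)
  then have "J (cen t1, cen t2) = k *\<^sub>R (cen t1, cen t2)"
    by (simp add: t(2) vec3_eq_iff)
  with t(1) show ?thesis using no_real_eigenvector[OF linear_J J_J] by blast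
next
  case False
  define D where "D = t1 * s2 - t2 * s1"
  \<comment> \<open>Cramer's rule: coordinates of the given central vector with respect to (t1, t2)
    and its image.\<close>
  define p q where "p = (a * s2 - b * s1) / D" and "q = (b * t1 - a * t2) / D"
  have "D \<noteq> 0" using False by (simp add: D_def)
  have "(a * s2 - b * s1) * t1 + (b * t1 - a * t2) * s1 = a * D"
    "(a * s2 - b * s1) * t2 + (b * t1 - a * t2) * s2 = b * D"
    unfolding D_def by algebra+
  then have "p * t1 + q * s1 = a" "p * t2 + q * s2 = b"
    using \<open>D \<noteq> 0\<close> by (simp_all add: p_def q_def field_simps)
  then have "(cen a, cen b) = p *\<^sub>R (cen t1, cen t2) + q *\<^sub>R J (cen t1, cen t2)"
    by (simp add: t(2) vec3_eq_iff)
  then have "J (cen a, cen b) = p *\<^sub>R J (cen t1, cen t2) + q *\<^sub>R (- (cen t1, cen t2))"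
    by (simp only: J_simps J_J)
  then have "J (cen a, cen b) = (cen (p * s1 - q * t1), cen (p * s2 - q * t2))"
    by (simp add: t(2) vec3_eq_iff)
  then show ?thesis by blast
qed

text \<open>Either some bracket of \<open>u\<close> is non-zero, and then it is a central vector
  whose image under \<open>J\<close> is again a bracket and so central; or all brackets of
  \<open>u\<close> vanish and \<open>u\<close> itself is central.\<close>

lemma center_invariant: "\<exists>c d. J (cen a, cen b) = (cen c, cen d)"
proof -
  define u where "u = J (cen a, cen b)"
  have zero: "prod_bracket heis (cen a, cen b) w = 0" for w
    by (simp add: prod_bracket_heis area_def zero_prod_def)
  have comm: "J (prod_bracket heis u w) = prod_bracket heis u (J w)" for w
    using nijenhuis_0[of "(cen a, cen b)" w]
    by (simp add: nijenhuis_def zero J_simps flip: u_def)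
  have "\<exists>c d. J (cen a, cen b) = (cen c, cen d)" if "prod_bracket heis u w \<noteq> 0" for w
    using that comm[of w] by (intro center_invariant_if) (simp_all add: prod_bracket_heis)
  moreover have "u = (cen (fst u $ 3), cen (snd u $ 3))" if "\<And>w. prod_bracket heis u w = 0"
    using that[of "(axis 1 1, axis 1 1)"] that[of "(axis 2 1, axis 2 1)"]
    by (simp add: prod_bracket_heis area_def prod_eq_iff vec3_eq_iff)
  ultimately show ?thesis unfolding u_def by blast
qed

lemma J_first_factor:
  "J (x, 0) = (x$1) *\<^sub>R J (axis 1 1, 0) + (x$2) *\<^sub>R J (axis 2 1, 0) + (x$3) *\<^sub>R J (cen 1, 0)"
proof -
  have "(x, 0) = (x$1) *\<^sub>R (axis 1 1, 0) + (x$2) *\<^sub>R (axis 2 1, 0) + (x$3) *\<^sub>R (cen 1, 0 :: real^3)"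
    by (simp add: vec3_eq_iff)
  then show ?thesis by (simp only: J_simps)
qed

lemma J_cen: "J (cen a, cen b) = a *\<^sub>R J (cen 1, 0) + b *\<^sub>R J (0, cen 1)"
proof -
  have "(cen a, cen b) = a *\<^sub>R (cen 1, 0) + b *\<^sub>R (0, cen 1)" by (simp add: vec3_eq_iff)
  then show ?thesis by (simp only: J_simps)
qed

text \<open>On the centre \<open>J\<close> has square -1, hence trace 0 and determinant 1; c = 0
  would give l^2 = -1.\<close>

lemma J_center:
  obtains l c m where "J (cen 1, 0) = (cen l, cen c)" "J (0, cen 1) = (cen m, cen (- l))"
    "c \<noteq> 0" "l * l + c * m = -1"
proof -
  obtain l c where lc: "J (cen 1, 0) = (cen l, cen c)" using center_invariant[of 1 0] by auto
  obtain m n where mn: "J (0, cen 1) = (cen m, cen n)" using center_invariant[of 0 1] by auto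
  have "J (J (cen 1, 0)) = l *\<^sub>R (cen l, cen c) + c *\<^sub>R (cen m, cen n)"
    using J_cen[of l c] by (simp only: lc mn)
  then have eqs: "l * l + c * m = -1" "l * c + c * n = 0"
    by (auto simp: vec3_eq_iff)
  have "c \<noteq> 0"
  proof
    assume "c = 0"
    with eqs(1) zero_le_square[of l] show False by simp
  qed
  with eqs(2) have "n = - l" by (metis add_eq_0_iff mult.commute mult_cancel_left distrib_left mult_eq_0_iff)
  with lc mn \<open>c \<noteq> 0\<close> eqs(1) show thesis by (intro that) auto
qed

section \<open>Non-zero trace: the second form\<close>

lemma matrix_II_exists:
  assumes e1: "J (axis 1 1, 0) = (p, r)" and e2: "J (axis 2 1, 0) = (q, s)"
    and l: "J (cen 1, 0) = (cen l, cen c)" "J (0, cen 1) = (cen m, cen (- l))"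
      "c \<noteq> 0" "l * l + c * m = -1"
    and rs: "area r s = (p$1 + q$2) * c" and tr: "1 + (p$1 + q$2) * l = area p q"
    and nz: "p$1 + q$2 \<noteq> 0"
  shows "\<exists>b X Y Z A B C. standard_basis b \<and> X + B \<noteq> 0 \<and> has_matrix J b (matrix_II X Y Z A B C)"
proof -
  define k where "k = p$1 + q$2"
  have k: "k \<noteq> 0" using nz by (simp add: k_def)
  have l_eq: "(p$1 * q$2 - 1 - q$1 * p$2) / k = l"
    using tr k by (simp add: area_def field_simps flip: k_def)
  \<comment> \<open>Dividing \<open>s\<close> by the trace \<open>k\<close> gives entry X + B in the
    fifth row and turns \<open>rs\<close> into [e1*, e2*] = e3*, where e3* = J e3 - \<lambda>
    e3.\<close>
  define b :: "((real^3) \<times> (real^3))^6" where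
    "b = vector [(axis 1 1, 0), (axis 2 1, 0), (cen 1, 0), (0, r), (0, (1/k) *\<^sub>R s), (0, cen c)]"
  have "area r ((1/k) *\<^sub>R s) = area r s / k"
    by (simp add: area_def diff_divide_distrib)
  then have "standard_basis b"
    unfolding b_def using rs l(3) k
    by (intro standard_basis_vector) (auto simp: area_def k_def)
  have Jc: "J (cen a, cen d) = (cen (a * l + d * m), cen (a * c - d * l))" for a d
    using J_cen[of a d] by (simp add: l vec3_eq_iff)
  have J0: "J (x, 0) = (x$1) *\<^sub>R (p, r) + (x$2) *\<^sub>R (q, s) + (x$3) *\<^sub>R (cen l, cen c)" for x
    by (subst J_first_factor) (simp only: e1 e2 l)
  \<comment> \<open>Applying \<open>J\<close> to these equations expresses the columns of e1* and
    e2* through \<open>J\<close> on the first factor.\<close>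
  have "(0, r) = J (axis 1 1, 0) - (p, 0)" "(0, s) = J (axis 2 1, 0) - (q, 0)"
    by (simp_all add: e1 e2)
  then have J4: "J (0, r) = - (axis 1 1, 0) - J (p, 0)" and J5: "J (0, s) = - (axis 2 1, 0) - J (q, 0)"
    by (simp_all only: J_simps J_J)
  have J5': "J (0, (1/k) *\<^sub>R s) = (1/k) *\<^sub>R J (0, s)"
    by (simp flip: J_simps)
  have mc: "c * m = - 1 - l * l" using l(4) by simp
  have "has_matrix J b (matrix_II (p$1) (p$2) (p$3) (q$1) (q$2) (q$3))"
    unfolding has_matrix_6 forall_6 using k l_eq mc
    apply (simp add: b_def vector_6 matrix_II_def Let_def J4 J5 J5' J0 e1 e2
        Jc[of 1 0, simplified] Jc[of 0 c, simplified] flip: k_def)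
    apply (simp add: vec3_eq_iff field_simps power2_eq_square)
    apply (simp add: k_def algebra_simps)
    done
  with \<open>standard_basis b\<close> nz show ?thesis by blast
qed

section \<open>Zero trace: the first form\<close>

lemma off_diagonal_vanishes:
  assumes e1: "J (axis 1 1, 0) = (p, r)" and e2: "J (axis 2 1, 0) = (q, s)"
    and c: "J (cen 1, 0) = (cen l, cen c)" "c \<noteq> 0"
    and rs: "area r s = 0" and tr: "p$1 + q$2 = 0" "area p q = 1"
  shows "r$1 = 0" "r$2 = 0" "s$1 = 0" "s$2 = 0" "p$2 \<noteq> 0"
    and "fst (J (0, w)) = cen (fst (J (0, w)) $ 3)"
proof -
  have J0: "J (x, 0) = (x$1) *\<^sub>R (p, r) + (x$2) *\<^sub>R (q, s) + (x$3) *\<^sub>R (cen l, cen c)" for x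
    by (subst J_first_factor) (simp only: e1 e2 c)
  have q2: "q$2 = - p$1" using tr(1) by simp
  have det: "p$1 * p$1 + q$1 * p$2 = -1"
    using tr(2) unfolding area_def q2 by algebra
  show p2: "p$2 \<noteq> 0"
  proof
    assume "p$2 = 0"
    with det zero_le_square[of "p$1"] show False by simp
  qed
  text \<open>A kernel direction \<open>(\<alpha>, \<beta>)\<close> of the off-diagonal block is moved by the diagonal block,
    which has characteristic polynomial \<open>t\<^sup>2 + 1\<close>, to an independent kernel direction.\<close>
  have kernel: "r$i = 0 \<and> s$i = 0"
    if ab: "\<alpha> \<noteq> 0 \<or> \<beta> \<noteq> 0" "\<alpha> * r$1 + \<beta> * s$1 = 0" "\<alpha> * r$2 + \<beta> * s$2 = 0"
      and i: "i \<in> {1, 2}" for \<alpha> \<beta> i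
  proof -
    define x where "x = \<alpha> *\<^sub>R axis 1 1 + \<beta> *\<^sub>R (axis 2 1 :: real^3)"
    define y where "y = \<alpha> *\<^sub>R p + \<beta> *\<^sub>R q"
    define k where "k = \<alpha> * r$3 + \<beta> * s$3"
    have "J (x, 0) = (y, cen k)"
      using ab by (simp add: J0 x_def y_def k_def vec3_eq_iff)
    then have "J (y, cen k) = - (x, 0)" by (metis J_J)
    moreover have "(y, 0) = (y, cen k) - (0, cen k)" by simp
    ultimately have "J (y, 0) = - (x, 0) - J (0, cen k)" by (simp only: J_simps)
    moreover obtain a d where "J (0, cen k) = (cen a, cen d)"
      using center_invariant[of 0 k] by auto
    ultimately have "snd (J (y, 0)) $ i = 0" using i by auto
    then have y: "y$1 * r$i + y$2 * s$i = 0" using i by (auto simp: J0)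
    \<comment> \<open>By \<open>det\<close>, the determinant of (\<alpha>, \<beta>) and its image
      is, up to the factor \<open>p$2\<close>, a sum of squares, so the two kernel directions are
      independent.\<close>
    have "p$2 * (\<alpha> * y$2 - \<beta> * y$1) = (p$2 * \<alpha> - p$1 * \<beta>)\<^sup>2 + \<beta>\<^sup>2"
      using det unfolding y_def by (simp add: q2) algebra
    moreover have "(p$2 * \<alpha> - p$1 * \<beta>)\<^sup>2 + \<beta>\<^sup>2 \<noteq> 0"
      using ab(1) p2 by (auto simp: sum_power2_eq_zero_iff)
    ultimately have D: "\<alpha> * y$2 - \<beta> * y$1 \<noteq> 0" by auto
    have ri: "\<alpha> * r$i + \<beta> * s$i = 0" using ab i by auto
    have "(\<alpha> * y$2 - \<beta> * y$1) * r$i = 0" "(\<alpha> * y$2 - \<beta> * y$1) * s$i = 0"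
      using y ri by algebra+
    with D show ?thesis by simp
  qed
  have "r$i = 0 \<and> s$i = 0" if i: "i \<in> {1, 2}" for i
  proof (rule ccontr)
    assume neg: "\<not> (r$i = 0 \<and> s$i = 0)"
    \<comment> \<open>As area r s = 0, a non-zero row (r_i, s_i) of the block yields the kernel
      direction (s_i, -r_i).\<close>
    have "s$i * r$1 + (- r$i) * s$1 = 0" "s$i * r$2 + (- r$i) * s$2 = 0"
      using rs i by (auto simp: area_def mult.commute)
    from kernel[OF _ this i] neg show False by auto
  qed
  then show r: "r$1 = 0" "r$2 = 0" "s$1 = 0" "s$2 = 0" by auto
  obtain f g where Jw: "J (0, w) = (f, g)" by (metis surj_pair)
  have Jc: "snd (J (cen a, 0)) = cen (a * c)" for a
    using J0[of "cen a"] by simp (simp add: vec3_eq_iff)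
  \<comment> \<open>Since J (axis i 1, 0) is now central in the second factor, only the bracket of
    (axis i 1, 0) with J (0, w) contributes here. As c \<noteq> 0, this forces \<open>f\<close> into
    the centre.\<close>
  have "snd (nijenhuis (prod_bracket heis) J (axis i 1, 0) (0, w)) = cen (area (axis i 1) f * c)"
    if "i \<in> {1, 2}" for i
    using that r
    by (auto simp: nijenhuis_def Jw prod_bracket_heis e1 e2 Jc area_def J_simps
      simp flip: zero_prod_def)
  then have "area (axis 1 1) f * c = 0" "area (axis 2 1) f * c = 0"
    by (auto simp: nijenhuis_0 vec3_eq_iff)
  then show "fst (J (0, w)) = cen (fst (J (0, w)) $ 3)"
    using c(2) by (simp add: Jw area_def vec3_eq_iff)
qed

text \<open>Produces each 2x2 block of the first form: \<open>y\<close> is chosen to give the first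
  column, and J^2 = -1 forces the second.\<close>

lemma J_pair:
  assumes "y = (1 / b) *\<^sub>R (J x - a *\<^sub>R x)" "b \<noteq> 0"
  shows "J x = a *\<^sub>R x + b *\<^sub>R y" "J y = ((-1 - a\<^sup>2) / b) *\<^sub>R x - a *\<^sub>R y"
proof -
  show Jx: "J x = a *\<^sub>R x + b *\<^sub>R y" using assms by simp
  have "J y = (1 / b) *\<^sub>R (- x - a *\<^sub>R (a *\<^sub>R x + b *\<^sub>R y))"
    unfolding Jx[symmetric] by (subst assms(1)) (simp add: J_simps)
  also have "\<dots> = ((-1 - a\<^sup>2) / b) *\<^sub>R x - a *\<^sub>R y"
    using assms(2) by (simp add: algebra_simps power2_eq_square diff_divide_distrib)
  finally show "J y = ((-1 - a\<^sup>2) / b) *\<^sub>R x - a *\<^sub>R y" .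
qed

lemma matrix_I_exists:
  assumes e1: "J (axis 1 1, 0) = (p, cen r)" and p2: "p$2 \<noteq> 0"
    and f1: "J (0, axis 1 1) = (cen g, q)"
    and l: "J (cen 1, 0) = (cen l, cen c)" "J (0, cen 1) = (cen m, cen (- l))"
      "c \<noteq> 0" "l * l + c * m = -1"
  shows "\<exists>b l X Xs Y Ys. standard_basis b \<and> Y \<noteq> 0 \<and> Ys \<noteq> 0 \<and> has_matrix J b (matrix_I l X Xs Y Ys)"
proof -
  have m: "m \<noteq> 0"
  proof
    assume "m = 0"
    with l(4) zero_le_square[of l] show False by simp
  qed
  have Jc: "J (cen a, cen d) = (cen (a * l + d * m), cen (a * c - d * l))" for a d
    using J_cen[of a d] by (simp add: l vec3_eq_iff)
  text \<open>Central shifts of \<open>e\<^sub>1\<close> and \<open>e\<^sub>1\<^sup>*\<close> make both factors invariant on them.\<close>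
  define u where "u = axis 1 1 + cen (- r / c)"
  define u' where "u' = p + cen (- r / c * l)"
  have "(u, 0) = (axis 1 1, 0) + (cen (- r / c), cen 0)" by (simp add: u_def)
  then have Ju: "J (u, 0) = (u', 0)"
    using l(3) by (simp only: J_simps e1 Jc) (simp add: u'_def vec3_eq_iff)
  define v where "v = axis 1 1 + cen (- g / m)"
  define v' where "v' = q + cen (g / m * l)"
  have "(0, v) = (0, axis 1 1) + (cen 0, cen (- g / m))" by (simp add: v_def)
  then have Jv: "J (0, v) = (0, v')"
    using m by (simp only: J_simps f1 Jc) (simp add: v'_def vec3_eq_iff)
  \<comment> \<open>Otherwise \<open>v\<close> would be an eigenvector modulo the centre with real
    eigenvalue \<open>q$1\<close>, whose square would be -1.\<close>
  have q2: "q$2 \<noteq> 0"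
  proof
    assume "q$2 = 0"
    define k where "k = v'$3 - q$1 * v$3"
    have "(0, v') = (q$1) *\<^sub>R (0, v) + (cen 0, cen k)"
      using \<open>q$2 = 0\<close> by (simp add: vec3_eq_iff v'_def v_def k_def)
    moreover have "J (0, v') = - (0, v)" by (metis Jv J_J)
    ultimately have "- (0, v) = (q$1) *\<^sub>R (0, v') + (cen (k * m), cen (- k * l))"
      by (simp only: J_simps Jv Jc) simp
    then have "- 1 = q$1 * q$1" by (simp add: vec3_eq_iff v'_def v_def)
    with zero_le_square[of "q$1"] show False by linarith
  qed
  \<comment> \<open>The division by \<open>c\<close> makes the area of \<open>v\<close> and
    \<open>z\<close> equal to \<open>c\<close>, so that e3* = (0, cen c), as the third column J e3 =
    l e3 + e3* demands.\<close>
  define X Y Xs Ys where "X = p$1" and "Y = p$2" and "Xs = q$1" and "Ys = q$2 / c"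
  have nz: "Y \<noteq> 0" "Ys \<noteq> 0" using p2 q2 l(3) by (simp_all add: Y_def Ys_def)
  define w where "w = (1 / Y) *\<^sub>R (u' - X *\<^sub>R u)"
  define z where "z = (1 / Ys) *\<^sub>R (v' - Xs *\<^sub>R v)"
  define b :: "((real^3) \<times> (real^3))^6" where
    "b = vector [(u, 0), (w, 0), (cen 1, 0), (0, v), (0, z), (0, cen c)]"
  have "area u w = 1"
    using p2 by (simp add: area_def u_def w_def u'_def Y_def)
  moreover have "area v z = c"
    using q2 l(3) by (simp add: area_def v_def z_def v'_def Ys_def)
  ultimately have "standard_basis b"
    unfolding b_def using l(3) by (intro standard_basis_vector) auto
  moreover have "has_matrix J b (matrix_I l X Xs Y Ys)"
  proof -
    have w: "(w, 0) = (1 / Y) *\<^sub>R (J (u, 0) - X *\<^sub>R (u, 0))" by (simp add: Ju w_def)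
    have z: "(0, z) = (1 / Ys) *\<^sub>R (J (0, v) - Xs *\<^sub>R (0, v))" by (simp add: Jv z_def)
    have c: "J (0, cen c) = (- 1 - l\<^sup>2) *\<^sub>R (cen 1, 0) - l *\<^sub>R (0, cen c)"
      using Jc[of 0 c] l(4) by (simp add: vec3_eq_iff power2_eq_square)
    have c': "J (cen 1, 0) = l *\<^sub>R (cen 1, 0) + (0, cen c)"
      by (simp add: l(1) vec3_eq_iff)
    show ?thesis
      unfolding has_matrix_6 forall_6 b_def matrix_I_def
      by (simp only: vector_6 J_pair[OF w nz(1)] J_pair[OF z nz(2)] c c') simp
  qed
  ultimately show ?thesis using nz by blast
qed

section \<open>Case distinction on the trace\<close>

lemma normal_form:
  "\<exists>b. standard_basis b \<and>
      ((\<exists>l X Xs Y Ys. Y \<noteq> 0 \<and> Ys \<noteq> 0 \<and> has_matrix J b (matrix_I l X Xs Y Ys)) \<or>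
       (\<exists>X Y Z A B C. X + B \<noteq> 0 \<and> has_matrix J b (matrix_II X Y Z A B C)))"
proof -
  obtain p r q s where e: "J (axis 1 1, 0) = (p, r)" "J (axis 2 1, 0) = (q, s)"
    by (metis surj_pair)
  obtain l c m where l: "J (cen 1, 0) = (cen l, cen c)" "J (0, cen 1) = (cen m, cen (- l))"
    "c \<noteq> 0" "l * l + c * m = -1"
    by (rule J_center)
  have "prod_bracket heis (J (axis 1 1, 0)) (axis 2 1, 0) = (p$1) *\<^sub>R (cen 1, 0)"
    "prod_bracket heis (axis 1 1, 0) (J (axis 2 1, 0)) = (q$2) *\<^sub>R (cen 1, 0)"
    by (simp_all add: e prod_bracket_heis area_def vec3_eq_iff)
  then have "nijenhuis (prod_bracket heis) J (axis 1 1, 0) (axis 2 1, 0) =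
    (cen (1 + (p$1 + q$2) * l - area p q), cen ((p$1 + q$2) * c - area r s))"
    unfolding nijenhuis_def by (simp only: J_simps l)
      (simp add: e prod_bracket_heis vec3_eq_iff area_def algebra_simps)
  then have N: "1 + (p$1 + q$2) * l = area p q" "area r s = (p$1 + q$2) * c"
    by (auto simp: nijenhuis_0 zero_prod_def vec3_eq_iff)
  show ?thesis
  proof (cases "p$1 + q$2 = 0")
    case False
    with matrix_II_exists[OF e l N(2,1)] show ?thesis by blast
  next
    case True
    have rs: "area r s = 0" "area p q = 1" using N True by simp_all
    note off = off_diagonal_vanishes[OF e l(1,3) rs(1) True rs(2)]
    have "r = cen (r$3)" using off by (simp add: vec3_eq_iff)
    with e(1) have "J (axis 1 1, 0) = (p, cen (r$3))" by simp
    moreover have "J (0, axis 1 1) = (cen (fst (J (0, axis 1 1)) $ 3), snd (J (0, axis 1 1)))"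
      using off(6)[of "axis 1 1"] by (simp add: prod_eq_iff)
    ultimately show ?thesis
      using matrix_I_exists[OF _ off(5) _ l] by metis
  qed
qed

end

theorem proposition7:
  shows "(\<forall>J. integrable_complex_structure heis J \<longrightarrow>
           (\<exists>b. standard_basis b \<and>
              ((\<exists>l X Xs Y Ys. Y \<noteq> 0 \<and> Ys \<noteq> 0 \<and> has_matrix J b (matrix_I l X Xs Y Ys)) \<or>
               (\<exists>X Y Z A B C. X + B \<noteq> 0 \<and> has_matrix J b (matrix_II X Y Z A B C)))))
       \<and> (\<forall>b. standard_basis b \<longrightarrow>
           (\<forall>l X Xs Y Ys. Y \<noteq> 0 \<and> Ys \<noteq> 0 \<longrightarrow>
              (\<exists>!J. linear J \<and> has_matrix J b (matrix_I l X Xs Y Ys)) \<and>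
              (\<forall>J. linear J \<and> has_matrix J b (matrix_I l X Xs Y Ys)
                 \<longrightarrow> integrable_complex_structure heis J)) \<and>
           (\<forall>X Y Z A B C. X + B \<noteq> 0 \<longrightarrow>
              (\<exists>!J. linear J \<and> has_matrix J b (matrix_II X Y Z A B C)) \<and>
              (\<forall>J. linear J \<and> has_matrix J b (matrix_II X Y Z A B C)
                 \<longrightarrow> integrable_complex_structure heis J)))"
proof -
  \<comment> \<open>The index type has six elements, the dimension of the product, so every matrix
    defines exactly one linear map.\<close>
  have "\<exists>!J. linear J \<and> has_matrix J b M" if "standard_basis b" for b and M :: "real^6^6"
    using ex1_linear_has_matrix[OF standard_basis_span[OF that]] by simp
  then show ?thesis
    by (intro conjI allI impI; (elim conjE)?)
      (assumption | rule matrix_I_integrable matrix_II_integrable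
        heis_complex_structure.normal_form[OF heis_complex_structure.intro])+
qed

end
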